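(* Let $n\ge 3$, $\alpha\in(0,n)$, $p,q>0$ with $pq>1$ and $p\le q$. Let $u,v$ be positive solutions on $\mathbb{R}^n$ of the system $$u(x)=\int_{\mathbb{R}^n}\frac{v^q(y)\,dy}{|x-y|^{n-\alpha}},\qquad v(x)=\int_{\mathbb{R}^n}\frac{u^p(y)\,dy}{|x-y|^{n-\alpha}}.$$ Then there exists $c>0$ such that for all sufficiently large $|x|$, $$u(x)\ge \frac{c}{|x|^{n-\alpha}},\qquad v(x)\ge \frac{c}{|x|^{\min\{n-\alpha,\;pn-(p+1)\alpha\}}}.$$ Moreover, if $u,v$ are bounded and tend to $0$ as $|x|\to\infty$, and there exists $\epsilon_0>0$ such that either $u(y)\ge \epsilon_0 u(x)$ for all $x,y$ with $|y|\le |x|$, or $v(y)\ge\epsilon_0 v(x)$ for all $x,y$ with $|y|\le|x|$, then there exists $C>0$ such that for all sufficiently large $|x|$, $$u(x)\le C|x|^{-\frac{\alpha(q+1)}{pq-1}},\qquad v(x)\le C|x|^{-\frac{\alpha(p+1)}{pq-1}}.$$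
   Context: A pair of positive solutions means positive measurable functions $u,v$ on $\mathbb{R}^n$ for which both integral identities hold (with finite values) at every $x\in\mathbb{R}^n$. *)

theory Defs
  imports "HOL-Analysis.Analysis"
begin

text \<open>A pair of positive solutions of the integral system on R^n (n = CARD('n)):
  u, v positive, Borel measurable, and for every x both integral identities hold
  with finite values. The integrals are Lebesgue integrals of nonnegative
  functions (nn_integral); equality with ennreal of a real number encodes finiteness.\<close>
definition positive_solution_pair ::
  "real \<Rightarrow> real \<Rightarrow> real \<Rightarrow> (real^'n \<Rightarrow> real) \<Rightarrow> (real^'n \<Rightarrow> real) \<Rightarrow> bool" where
  "positive_solution_pair \<alpha> p q u v \<longleftrightarrow>
     u \<in> borel_measurable lborel \<and> v \<in> borel_measurable lborel \<and>
     (\<forall>x. u x > 0) \<and> (\<forall>x. v x > 0) \<and>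
     (\<forall>x. ennreal (u x) =
        (\<integral>\<^sup>+ y. ennreal (v y powr q / dist x y powr (real CARD('n) - \<alpha>)) \<partial>lborel)) \<and>
     (\<forall>x. ennreal (v x) =
        (\<integral>\<^sup>+ y. ennreal (u y powr p / dist x y powr (real CARD('n) - \<alpha>)) \<partial>lborel))"

end

theory Submission
  imports Defs
begin

text \<open>Write \<open>\<beta> = n - \<alpha>\<close>, \<open>a = \<alpha> (q + 1) / (p q - 1)\<close> and \<open>b = \<alpha> (p + 1) / (p q - 1)\<close>, so that
  \<open>p a = \<alpha> + b\<close> and \<open>q b = \<alpha> + a\<close>. The lower bounds come from restricting the integrals to the
  unit ball, respectively to \<open>B(x, |x|/2)\<close>. If \<open>u\<close> is almost decreasing, restricting both integrals
  to \<open>B(0, |x|)\<close> gives \<open>u(x) \<ge> c |x|^(\<alpha> (q + 1)) u(x)^(p q)\<close>, that is \<open>u(x) \<le> C |x|^(-a)\<close>. This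
  forces \<open>a < \<beta>\<close>: for \<open>a \<ge> \<beta>\<close> the lower bound on \<open>v\<close> makes the integral of \<open>v^q\<close> diverge, so
  \<open>u(x) |x|^\<beta>\<close> tends to infinity. Since \<open>b \<le> a\<close>, we get \<open>\<alpha> < p a < n\<close>, and the Riesz potential of \<open>|y|^(-p a)\<close>
  is of order \<open>|x|^(-b)\<close>, which bounds \<open>v\<close>. If instead \<open>v\<close> is almost decreasing, the roles are
  exchanged; the divergence of \<open>u(x) |x|^\<beta>\<close> is then transferred to \<open>v\<close> before it contradicts
  \<open>v(x) \<le> C |x|^(-b)\<close>.\<close>

section \<open>Riesz potentials of powers of the norm\<close>

text \<open>Up to a normalising constant this is the Riesz potential of order
  \<open>DIM('a) - \<beta>\<close>. Values in \<open>ennreal\<close> admit divergent integrals. At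
  \<open>y = x\<close> the quotient is 0 by convention, which affects only a null set.\<close>

definition riesz_pot :: "real \<Rightarrow> ('a::euclidean_space \<Rightarrow> real) \<Rightarrow> 'a \<Rightarrow> ennreal" where
  "riesz_pot \<beta> f x = (\<integral>\<^sup>+ y. ennreal (f y / dist x y powr \<beta>) \<partial>lborel)"

lemma exists_dyadic_scale:
  fixes d :: real
  assumes "d \<ge> 1"
  shows "\<exists>k. 2 ^ k \<le> d \<and> d < 2 ^ Suc k"
proof -
  define k where "k = (LEAST k. d < 2 ^ k)"
  have "\<exists>k. d < 2 ^ k"
    using real_arch_pow[of 2 d] by auto
  then have 1: "d < 2 ^ k"
    unfolding k_def by (rule LeastI_ex)
  then obtain j where j: "k = Suc j"
    using assms by (cases k) auto
  have "\<not> d < 2 ^ j"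
    using not_less_Least[of j "\<lambda>k. d < 2 ^ k"] j unfolding k_def by simp
  then show ?thesis using 1 j by force
qed

text \<open>The sum over \<open>k\<close> of \<open>c k\<close> times the indicator of the
  \<open>k\<close>-th ball dominates the integrand, since one matching term already does. Overlaps
  only enlarge the bound. The centre \<open>z\<close>, which lies in no dyadic shell, is dropped as
  a null set, and nonpositive values of \<open>g\<close> vanish under
  \<open>ennreal\<close>.\<close>

lemma nn_integral_le_suminf_balls:
  fixes g :: "'a::euclidean_space \<Rightarrow> real" and c \<rho> :: "nat \<Rightarrow> real"
  assumes g: "\<And>y. y \<noteq> z \<Longrightarrow> g y > 0 \<Longrightarrow> \<exists>k. y \<in> ball z (\<rho> k) \<and> g y \<le> c k"
    and nonneg: "\<And>k. c k \<ge> 0" "\<And>k. \<rho> k \<ge> 0"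
    and sums: "(\<lambda>k. c k * (unit_ball_vol DIM('a) * \<rho> k ^ DIM('a))) sums S"
  shows "(\<integral>\<^sup>+ y. ennreal (g y) \<partial>lborel) \<le> ennreal S"
proof -
  have "AE y in (lborel :: 'a measure). y \<noteq> z"
    by (rule AE_lborel_singleton)
  then have "(\<integral>\<^sup>+ y. ennreal (g y) \<partial>lborel) \<le>
      (\<integral>\<^sup>+ y. (\<Sum>k. ennreal (c k) * indicator (ball z (\<rho> k)) y) \<partial>lborel)"
  proof (intro nn_integral_mono_AE, elim eventually_mono)
    fix y assume "y \<noteq> z"
    show "ennreal (g y) \<le> (\<Sum>k. ennreal (c k) * indicator (ball z (\<rho> k)) y)"
    proof (cases "g y > 0")
      case True
      then obtain k where k: "y \<in> ball z (\<rho> k)" "g y \<le> c k"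
        using g[OF \<open>y \<noteq> z\<close>] by blast
      define h where "h k = ennreal (c k) * indicator (ball z (\<rho> k)) y" for k
      have "ennreal (g y) \<le> h k"
        using k by (simp add: h_def ennreal_leI)
      also have "\<dots> \<le> (\<Sum>k. h k)"
        using sum_le_suminf[of h "{k}"] by simp
      finally show ?thesis unfolding h_def .
    qed (simp add: ennreal_neg)
  qed
  also have "\<dots> = (\<Sum>k. \<integral>\<^sup>+ y. ennreal (c k) * indicator (ball z (\<rho> k)) y \<partial>lborel)"
    by (intro nn_integral_suminf borel_measurable_times_ennreal borel_measurable_const
        borel_measurable_indicator) simp
  also have "\<dots> = (\<Sum>k. ennreal (c k * (unit_ball_vol DIM('a) * \<rho> k ^ DIM('a))))"
    by (simp add: nn_integral_cmult_indicator emeasure_ball nonneg ennreal_mult)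
  also have "\<dots> = ennreal S"
    using sums by (subst suminf_ennreal2) (auto simp: nonneg sums_iff)
  finally show ?thesis .
qed

text \<open>Serves both dyadic decompositions: shrinking shells with \<open>b = 1/2\<close> and
  positive \<gamma>, growing shells with \<open>b = 2\<close> and negative \<gamma>.\<close>

lemma geometric_powr_sums:
  fixes b r \<gamma> :: real
  assumes "b > 0" "r > 0" "b powr \<gamma> < 1"
  shows "(\<lambda>k. (r * b ^ k) powr \<gamma>) sums (r powr \<gamma> / (1 - b powr \<gamma>))"
proof -
  have "(r * b ^ k) powr \<gamma> = r powr \<gamma> * (b powr \<gamma>) ^ k" for k
  proof -
    have "(b ^ k) powr \<gamma> = (b powr \<gamma>) ^ k"
      using assms by (simp add: powr_realpow[symmetric] powr_powr mult.commute)
    then show ?thesis using assms by (simp add: powr_mult)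
  qed
  then show ?thesis
    using sums_mult[OF geometric_sums[of "b powr \<gamma>"], of "r powr \<gamma>"] assms by simp
qed

text \<open>The shell at distance about \<open>w = r * (1/2) ^ k\<close> has volume of order
  \<open>w ^ DIM('a)\<close> and integrand of order \<open>w powr - s\<close>. The contributions
  form a geometric series, convergent because \<open>s < DIM('a)\<close>.\<close>

lemma nn_integral_dist_powr_ball:
  fixes s :: real
  assumes "0 \<le> s" "s < DIM('a::euclidean_space)"
  shows "\<exists>C>0. \<forall>(z::'a) r. r > 0 \<longrightarrow>
    (\<integral>\<^sup>+ y. ennreal (indicator (ball z r) y * dist z y powr - s) \<partial>lborel)
      \<le> ennreal (C * r powr (DIM('a) - s))"
proof -
  define \<gamma> where "\<gamma> = DIM('a) - s"
  have "\<gamma> > 0" using assms by (simp add: \<gamma>_def)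
  then have \<theta>: "(1/2::real) powr \<gamma> < 1"
    using powr_less_mono'[of "1/2" 0 \<gamma>] by simp
  \<comment> \<open>\<open>D\<close> is the coefficient of \<open>w powr \<gamma>\<close> in the
    height \<open>(1/2 * w) powr - s\<close> times the volume of a ball of radius
    \<open>2 * w\<close>.\<close>
  define D where "D = (1/2) powr - s * unit_ball_vol DIM('a) * 2 ^ DIM('a)"
  define C where "C = D / (1 - (1/2) powr \<gamma>)"
  have "C > 0"
    unfolding C_def D_def using \<theta> by simp
  moreover have "(\<integral>\<^sup>+ y. ennreal (indicator (ball z r) y * dist z y powr - s) \<partial>lborel)
      \<le> ennreal (C * r powr \<gamma>)" if r: "r > 0" for z :: 'a and r
  proof (rule nn_integral_le_suminf_balls[where z = z and \<rho> = "\<lambda>k. 2 * (r * (1/2) ^ k)"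
        and c = "\<lambda>k. (1/2 * (r * (1/2) ^ k)) powr - s"])
    fix y assume y: "y \<noteq> z" "0 < indicator (ball z r) y * dist z y powr - s"
    then have d: "0 < dist z y" "dist z y < r"
      by (auto simp: indicator_def of_bool_def split: if_splits)
    obtain k where k: "2 ^ k \<le> r / dist z y" "r / dist z y < 2 ^ Suc k"
      using exists_dyadic_scale[of "r / dist z y"] d by auto
    have k1: "r * (1/2) ^ k \<ge> dist z y"
      using k(1) d by (simp add: field_simps)
    have k2: "1/2 * (r * (1/2) ^ k) \<le> dist z y"
      using k(2) d by (simp add: field_simps)
    \<comment> \<open>The index only gives \<open>dist z y \<le> r * (1/2) ^ k\<close>; doubling the
      radius makes the inequality strict, as the open ball demands.\<close>
    have "y \<in> ball z (2 * (r * (1/2) ^ k))"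
      unfolding mem_ball using k1 d by linarith
    moreover have "dist z y powr - s \<le> (1/2 * (r * (1/2) ^ k)) powr - s"
      using k2 assms r by (intro powr_mono2') auto
    ultimately show "\<exists>k. y \<in> ball z (2 * (r * (1/2) ^ k)) \<and>
        indicator (ball z r) y * dist z y powr - s \<le> (1/2 * (r * (1/2) ^ k)) powr - s"
      using d by (intro exI[of _ k]) simp
  next
    have "(1/2 * w) powr - s * (unit_ball_vol DIM('a) * (2 * w) ^ DIM('a)) = D * w powr \<gamma>"
      if "w > 0" for w :: real
    proof -
      have "w powr \<gamma> = w powr - s * w ^ DIM('a)"
        using that by (simp add: \<gamma>_def powr_add[symmetric] powr_realpow[symmetric])
      moreover have "(1/2 * w) powr - s = (1/2) powr - s * w powr - s"
        using that by (subst powr_mult) auto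
      ultimately show ?thesis
        unfolding D_def power_mult_distrib by (simp only: mult_ac)
    qed
    then have eq: "(1/2 * (r * (1/2) ^ k)) powr - s * (unit_ball_vol DIM('a) * (2 * (r * (1/2) ^ k)) ^ DIM('a))
        = D * (r * (1/2) ^ k) powr \<gamma>" for k
      using r by simp
    show "(\<lambda>k. (1/2 * (r * (1/2) ^ k)) powr - s * (unit_ball_vol DIM('a) * (2 * (r * (1/2) ^ k)) ^ DIM('a)))
        sums (C * r powr \<gamma>)"
      unfolding eq using sums_mult[OF geometric_powr_sums[of "1/2" r \<gamma>], of D] \<theta> r
      by (simp add: C_def)
  qed (use r in auto)
  ultimately show ?thesis unfolding \<gamma>_def by blast
qed

text \<open>The same decomposition with shells growing outwards from radius \<open>r\<close>; now
  \<open>DIM('a) - t\<close> is negative and the series converges at infinity.\<close>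

lemma nn_integral_dist_powr_outside_ball:
  fixes t :: real
  assumes "t > DIM('a::euclidean_space)"
  shows "\<exists>C>0. \<forall>(z::'a) r. r > 0 \<longrightarrow>
    (\<integral>\<^sup>+ y. ennreal (indicator (- ball z r) y * dist z y powr - t) \<partial>lborel)
      \<le> ennreal (C * r powr (DIM('a) - t))"
proof -
  define \<gamma> where "\<gamma> = DIM('a) - t"
  have "\<gamma> < 0" using assms by (simp add: \<gamma>_def)
  then have \<theta>: "(2::real) powr \<gamma> < 1"
    using powr_less_mono[of \<gamma> 0 2] by simp
  define D where "D = unit_ball_vol DIM('a) * 2 ^ DIM('a)"
  define C where "C = D / (1 - 2 powr \<gamma>)"
  have "C > 0"
    unfolding C_def D_def using \<theta> by simp
  moreover have "(\<integral>\<^sup>+ y. ennreal (indicator (- ball z r) y * dist z y powr - t) \<partial>lborel)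
      \<le> ennreal (C * r powr \<gamma>)" if r: "r > 0" for z :: 'a and r
  proof (rule nn_integral_le_suminf_balls[where z = z and \<rho> = "\<lambda>k. 2 * (r * 2 ^ k)"
        and c = "\<lambda>k. (r * 2 ^ k) powr - t"])
    fix y assume y: "y \<noteq> z" "0 < indicator (- ball z r) y * dist z y powr - t"
    then have d: "0 < dist z y" "dist z y \<ge> r"
      by (auto simp: indicator_def of_bool_def split: if_splits)
    obtain k where k: "2 ^ k \<le> dist z y / r" "dist z y / r < 2 ^ Suc k"
      using exists_dyadic_scale[of "dist z y / r"] d r by auto
    have "y \<in> ball z (2 * (r * 2 ^ k))" using k(2) r by (simp add: field_simps)
    moreover have "dist z y powr - t \<le> (r * 2 ^ k) powr - t"
      using k(1) assms r by (intro powr_mono2') (auto simp: field_simps)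
    ultimately show "\<exists>k. y \<in> ball z (2 * (r * 2 ^ k)) \<and>
        indicator (- ball z r) y * dist z y powr - t \<le> (r * 2 ^ k) powr - t"
      using d by (intro exI[of _ k]) simp
  next
    have "w powr - t * (unit_ball_vol DIM('a) * (2 * w) ^ DIM('a)) = D * w powr \<gamma>"
      if "w > 0" for w :: real
    proof -
      have "w powr \<gamma> = w powr - t * w ^ DIM('a)"
        using that by (simp add: \<gamma>_def powr_add[symmetric] powr_realpow[symmetric])
      then show ?thesis
        unfolding D_def power_mult_distrib by (simp only: mult_ac)
    qed
    then have eq: "(r * 2 ^ k) powr - t * (unit_ball_vol DIM('a) * (2 * (r * 2 ^ k)) ^ DIM('a))
        = D * (r * 2 ^ k) powr \<gamma>" for k
      using r by simp
    show "(\<lambda>k. (r * 2 ^ k) powr - t * (unit_ball_vol DIM('a) * (2 * (r * 2 ^ k)) ^ DIM('a)))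
        sums (C * r powr \<gamma>)"
      unfolding eq using sums_mult[OF geometric_powr_sums[of 2 r \<gamma>], of D] \<theta> r
      by (simp add: C_def)
  qed (use r in auto)
  ultimately show ?thesis unfolding \<gamma>_def by blast
qed

lemma measurable_indicator_dist_powr:
  assumes "S \<in> sets borel"
  shows "(\<lambda>y. indicator S y * dist z y powr s) \<in> borel_measurable (borel :: 'a::euclidean_space measure)"
  using assms
  by (intro borel_measurable_times borel_measurable_indicator powr_real_measurable
      borel_measurable_dist borel_measurable_const measurable_ident_sets) auto

lemma nn_integral_cmult_indicator_dist_powr:
  assumes "S \<in> sets borel" "c \<ge> 0"
  shows "(\<integral>\<^sup>+ y. ennreal (c * (indicator S y * dist (z::'a::euclidean_space) y powr s)) \<partial>lborel) =
    ennreal c * (\<integral>\<^sup>+ y. ennreal (indicator S y * dist z y powr s) \<partial>lborel)"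
  unfolding ennreal_mult'[OF assms(2)]
  by (rule nn_integral_cmult)
    (simp only: measurable_lborel2 measurable_compose[OF measurable_indicator_dist_powr[OF assms(1)] measurable_ennreal])

text \<open>The bounds on \<open>s\<close>, on \<beta> and on \<open>s + \<beta>\<close> give
  integrability at 0, at \<open>x\<close> and at infinity respectively. Splitting at the scale
  \<open>norm x / 2\<close>, every region contributes the same power of \<open>norm x\<close>, as
  scaling predicts.\<close>

lemma riesz_pot_norm_powr_le:
  fixes s \<beta> :: real
  assumes s: "0 \<le> s" "s < DIM('a::euclidean_space)" and \<beta>: "0 \<le> \<beta>" "\<beta> < DIM('a)"
    and s\<beta>: "s + \<beta> > DIM('a)"
  shows "\<exists>C>0. \<forall>x::'a. x \<noteq> 0 \<longrightarrow>
    riesz_pot \<beta> (\<lambda>y. norm y powr - s) x \<le> ennreal (C * norm x powr (DIM('a) - s - \<beta>))"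
proof -
  obtain A where A: "A > 0" "\<And>(z::'a) r. r > 0 \<Longrightarrow>
      (\<integral>\<^sup>+ y. ennreal (indicator (ball z r) y * dist z y powr - s) \<partial>lborel) \<le> ennreal (A * r powr (DIM('a) - s))"
    using nn_integral_dist_powr_ball[OF s] by blast
  obtain B where B: "B > 0" "\<And>(z::'a) r. r > 0 \<Longrightarrow>
      (\<integral>\<^sup>+ y. ennreal (indicator (ball z r) y * dist z y powr - \<beta>) \<partial>lborel) \<le> ennreal (B * r powr (DIM('a) - \<beta>))"
    using nn_integral_dist_powr_ball[OF \<beta>] by blast
  obtain E where E: "E > 0" "\<And>(z::'a) r. r > 0 \<Longrightarrow>
      (\<integral>\<^sup>+ y. ennreal (indicator (- ball z r) y * dist z y powr - (s + \<beta>)) \<partial>lborel)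
        \<le> ennreal (E * r powr (DIM('a) - (s + \<beta>)))"
    using nn_integral_dist_powr_outside_ball[OF s\<beta>] by blast
  \<comment> \<open>The term \<open>2 * E\<close> comes from the two outer regions, and the power of
    \<open>1/2\<close> converts \<open>r = norm x / 2\<close> back to \<open>norm x\<close>.\<close>
  define C where "C = (A + B + 2 * E) * (1/2) powr (DIM('a) - s - \<beta>)"
  have "C > 0" unfolding C_def using A B E by simp
  moreover have "riesz_pot \<beta> (\<lambda>y. norm y powr - s) x \<le> ennreal (C * norm x powr (DIM('a) - s - \<beta>))"
    if x: "x \<noteq> 0" for x :: 'a
  proof -
    define r where "r = norm x / 2"
    have r: "r > 0" using x by (simp add: r_def)
    \<comment> \<open>\<open>f1\<close> and \<open>f2\<close> majorise the integrand near the poles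
      0 and \<open>x\<close>; \<open>f3\<close> and \<open>f4\<close> do so elsewhere, by replacing
      the larger of the two distances with the smaller.\<close>
    define f1 where "f1 = (\<lambda>y::'a. r powr - \<beta> * (indicator (ball 0 r) y * dist 0 y powr - s))"
    define f2 where "f2 = (\<lambda>y. r powr - s * (indicator (ball x r) y * dist x y powr - \<beta>))"
    define f3 where "f3 = (\<lambda>y::'a. indicator (- ball 0 r) y * dist 0 y powr - (s + \<beta>))"
    define f4 where "f4 = (\<lambda>y. indicator (- ball x r) y * dist x y powr - (s + \<beta>))"
    note f_defs = f1_def f2_def f3_def f4_def
    have nonneg: "f1 y \<ge> 0" "f2 y \<ge> 0" "f3 y \<ge> 0" "f4 y \<ge> 0" for y
      by (simp_all add: f_defs)
    have meas: "f1 \<in> borel_measurable borel" "f2 \<in> borel_measurable borel"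
        "f3 \<in> borel_measurable borel" "f4 \<in> borel_measurable borel"
      unfolding f_defs
      by (intro borel_measurable_times borel_measurable_const measurable_indicator_dist_powr; simp add: borel_closed)+
    have pt: "norm y powr - s / dist x y powr \<beta> \<le> f1 y + f2 y + f3 y + f4 y" for y
    proof -
      have eq: "norm y powr - s / dist x y powr \<beta> = norm y powr - s * dist x y powr - \<beta>"
        by (simp add: powr_minus divide_inverse)
      \<comment> \<open>Since \<open>norm x = 2 * r\<close>, a point within \<open>r\<close> of one
        pole is at distance at least \<open>r\<close> from the other, which bounds the other
        factor.\<close>
      have tri: "2 * r \<le> norm y + dist x y"
        using dist_triangle[of x 0 y] by (simp add: r_def dist_commute)
      consider "norm y < r" | "dist x y < r" | "norm y \<ge> r" "dist x y \<ge> r" "norm y \<le> dist x y"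
        | "norm y \<ge> r" "dist x y \<ge> r" "dist x y \<le> norm y" by linarith
      then show ?thesis
      proof cases
        case 1
        have "dist x y powr - \<beta> \<le> r powr - \<beta>"
          using 1 tri r \<beta> by (intro powr_mono2') auto
        then have "norm y powr - s * dist x y powr - \<beta> \<le> f1 y"
          using 1 mult_left_mono[of "dist x y powr - \<beta>" "r powr - \<beta>" "norm y powr - s"]
          by (simp add: f1_def mult.commute)
        then show ?thesis unfolding eq using nonneg[of y] by linarith
      next
        case 2
        have "norm y powr - s \<le> r powr - s"
          using 2 tri r s by (intro powr_mono2') auto
        then have "norm y powr - s * dist x y powr - \<beta> \<le> f2 y"
          using 2 by (simp add: f2_def mult_right_mono)
        then show ?thesis unfolding eq using nonneg[of y] by linarith
      next
        case 3
        have "dist x y powr - \<beta> \<le> norm y powr - \<beta>"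
          using 3 r \<beta> by (intro powr_mono2') auto
        then have "norm y powr - s * dist x y powr - \<beta> \<le> norm y powr - s * norm y powr - \<beta>"
          by (simp add: mult_left_mono)
        also have "\<dots> = f3 y" using 3 by (simp add: f3_def powr_add[symmetric])
        finally show ?thesis unfolding eq using nonneg[of y] by linarith
      next
        case 4
        have "norm y powr - s \<le> dist x y powr - s"
          using 4 r s by (intro powr_mono2') auto
        then have "norm y powr - s * dist x y powr - \<beta> \<le> dist x y powr - s * dist x y powr - \<beta>"
          by (simp add: mult_right_mono)
        also have "\<dots> = f4 y" using 4 by (simp add: f4_def powr_add[symmetric])
        finally show ?thesis unfolding eq using nonneg[of y] by linarith
      qed
    qed
    define \<gamma> where "\<gamma> = DIM('a) - s - \<beta>"
    have i1: "(\<integral>\<^sup>+ y. ennreal (f1 y) \<partial>lborel) \<le> ennreal (A * r powr \<gamma>)"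
    proof -
      have "(\<integral>\<^sup>+ y. ennreal (f1 y) \<partial>lborel) = ennreal (r powr - \<beta>) *
          (\<integral>\<^sup>+ y. ennreal (indicator (ball (0::'a) r) y * dist 0 y powr - s) \<partial>lborel)"
        unfolding f1_def
        by (rule nn_integral_cmult_indicator_dist_powr) simp_all
      also have "\<dots> \<le> ennreal (r powr - \<beta>) * ennreal (A * r powr (DIM('a) - s))"
        by (intro mult_left_mono A(2) r) auto
      also have "\<dots> = ennreal (A * (r powr - \<beta> * r powr (DIM('a) - s)))"
        using A(1) by (simp add: ennreal_mult[symmetric] mult_ac)
      also have "r powr - \<beta> * r powr (DIM('a) - s) = r powr \<gamma>"
        unfolding powr_add[symmetric] by (simp add: \<gamma>_def algebra_simps)
      finally show ?thesis .
    qed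
    have i2: "(\<integral>\<^sup>+ y. ennreal (f2 y) \<partial>lborel) \<le> ennreal (B * r powr \<gamma>)"
    proof -
      have "(\<integral>\<^sup>+ y. ennreal (f2 y) \<partial>lborel) = ennreal (r powr - s) *
          (\<integral>\<^sup>+ y. ennreal (indicator (ball x r) y * dist x y powr - \<beta>) \<partial>lborel)"
        unfolding f2_def
        by (rule nn_integral_cmult_indicator_dist_powr) simp_all
      also have "\<dots> \<le> ennreal (r powr - s) * ennreal (B * r powr (DIM('a) - \<beta>))"
        by (intro mult_left_mono B(2) r) auto
      also have "\<dots> = ennreal (B * (r powr - s * r powr (DIM('a) - \<beta>)))"
        using B(1) by (simp add: ennreal_mult[symmetric] mult_ac)
      also have "r powr - s * r powr (DIM('a) - \<beta>) = r powr \<gamma>"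
        unfolding powr_add[symmetric] by (simp add: \<gamma>_def algebra_simps)
      finally show ?thesis .
    qed
    have \<gamma>': "DIM('a) - (s + \<beta>) = \<gamma>" by (simp add: \<gamma>_def)
    have i3: "(\<integral>\<^sup>+ y. ennreal (f3 y) \<partial>lborel) \<le> ennreal (E * r powr \<gamma>)"
      and i4: "(\<integral>\<^sup>+ y. ennreal (f4 y) \<partial>lborel) \<le> ennreal (E * r powr \<gamma>)"
      unfolding f3_def f4_def by (rule E(2)[OF r, unfolded \<gamma>'])+
    have "riesz_pot \<beta> (\<lambda>y. norm y powr - s) x
        \<le> (\<integral>\<^sup>+ y. ennreal (f1 y) + ennreal (f2 y) + ennreal (f3 y) + ennreal (f4 y) \<partial>lborel)"
      unfolding riesz_pot_def using pt nonneg
      by (intro nn_integral_mono) (auto simp: ennreal_plus[symmetric] simp del: ennreal_plus intro!: ennreal_leI)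
    also have "\<dots> = (\<integral>\<^sup>+ y. ennreal (f1 y) \<partial>lborel) + (\<integral>\<^sup>+ y. ennreal (f2 y) \<partial>lborel)
        + (\<integral>\<^sup>+ y. ennreal (f3 y) \<partial>lborel) + (\<integral>\<^sup>+ y. ennreal (f4 y) \<partial>lborel)"
      using meas by (simp add: nn_integral_add)
    also have "\<dots> \<le> ennreal (A * r powr \<gamma>) + ennreal (B * r powr \<gamma>) + ennreal (E * r powr \<gamma>) + ennreal (E * r powr \<gamma>)"
      by (intro add_mono i1 i2 i3 i4)
    also have "\<dots> = ennreal ((A + B + 2 * E) * r powr \<gamma>)"
      using A B E by (simp add: ennreal_plus[symmetric] algebra_simps del: ennreal_plus)
    also have "(A + B + 2 * E) * r powr \<gamma> = C * norm x powr \<gamma>"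
      unfolding C_def r_def \<gamma>_def by (simp add: powr_divide)
    finally show ?thesis by (simp add: \<gamma>_def)
  qed
  ultimately show ?thesis by blast
qed

section \<open>Lower estimates by restriction of the integral\<close>

text \<open>On \<open>S\<close> the kernel is at least \<open>D powr - \<beta>\<close>. The point
  \<open>y = x\<close> is left out because there the quotient is 0 by convention rather than
  infinite, so the pointwise comparison may fail.\<close>

lemma riesz_pot_ge_nn_integral:
  fixes f :: "'a::euclidean_space \<Rightarrow> real"
  assumes "f \<in> borel_measurable borel" "\<And>y. f y \<ge> 0" "S \<in> sets borel"
    and "\<beta> \<ge> 0" "D > 0" "\<And>y. y \<in> S \<Longrightarrow> dist x y \<le> D"
  shows "ennreal (D powr - \<beta>) * (\<integral>\<^sup>+ y. ennreal (indicator S y * f y) \<partial>lborel) \<le> riesz_pot \<beta> f x"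
proof -
  have "ennreal (D powr - \<beta>) * (\<integral>\<^sup>+ y. ennreal (indicator S y * f y) \<partial>lborel)
      = (\<integral>\<^sup>+ y. ennreal (D powr - \<beta>) * ennreal (indicator S y * f y) \<partial>lborel)"
  proof (rule nn_integral_cmult[symmetric])
    have "(\<lambda>y. indicator S y * f y) \<in> borel_measurable borel"
      using assms by (intro borel_measurable_times borel_measurable_indicator)
    then show "(\<lambda>y. ennreal (indicator S y * f y)) \<in> borel_measurable lborel"
      by (simp only: measurable_lborel2 measurable_compose[OF _ measurable_ennreal])
  qed
  also have "\<dots> \<le> riesz_pot \<beta> f x"
    unfolding riesz_pot_def
  proof (rule nn_integral_mono_AE)
    have "AE y in lborel. y \<noteq> x"
      by (rule AE_lborel_singleton)
    then show "AE y in lborel. ennreal (D powr - \<beta>) * ennreal (indicator S y * f y)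
        \<le> ennreal (f y / dist x y powr \<beta>)"
    proof (elim eventually_mono)
      fix y assume "y \<noteq> x"
      have "D powr - \<beta> * f y \<le> dist x y powr - \<beta> * f y" if "y \<in> S"
        using assms \<open>y \<noteq> x\<close> that by (intro mult_right_mono powr_mono2') auto
      then have "D powr - \<beta> * (indicator S y * f y) \<le> f y / dist x y powr \<beta>"
        using assms(2)[of y] by (cases "y \<in> S") (auto simp: powr_minus divide_inverse mult.commute)
      then show "ennreal (D powr - \<beta>) * ennreal (indicator S y * f y) \<le> ennreal (f y / dist x y powr \<beta>)"
        using assms(2)[of y] by (simp add: ennreal_mult[symmetric] ennreal_leI)
    qed
  qed
  finally show ?thesis .
qed

lemma nn_integral_indicator_ge:
  fixes f :: "'a::euclidean_space \<Rightarrow> real"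
  assumes "m \<ge> 0" "r \<ge> 0" "\<And>y. y \<in> ball z r \<Longrightarrow> m \<le> f y"
  shows "ennreal (m * (unit_ball_vol DIM('a) * r ^ DIM('a)))
    \<le> (\<integral>\<^sup>+ y. ennreal (indicator (ball z r) y * f y) \<partial>lborel)"
proof -
  have "ennreal (m * (unit_ball_vol DIM('a) * r ^ DIM('a)))
      = (\<integral>\<^sup>+ y. ennreal m * indicator (ball z r) y \<partial>lborel)"
    using assms by (simp add: nn_integral_cmult_indicator emeasure_ball ennreal_mult)
  also have "\<dots> \<le> (\<integral>\<^sup>+ y. ennreal (indicator (ball z r) y * f y) \<partial>lborel)"
    using assms(3) by (intro nn_integral_mono) (auto simp: indicator_def of_bool_def ennreal_leI)
  finally show ?thesis .
qed

section \<open>Lower bounds for solutions of the system\<close>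

text \<open>The assumptions are invariant under exchanging \<open>p\<close> with \<open>q\<close>
  and \<open>u\<close> with \<open>v\<close>, so each result about one component has a mirror image
  obtained through \<open>swap\<close>.\<close>

locale riesz_system =
  fixes \<alpha> \<beta> p q :: real and u v :: "'a::euclidean_space \<Rightarrow> real"
  assumes \<alpha>_pos: "\<alpha> > 0" and \<beta>_pos: "\<beta> > 0" and dim: "\<alpha> + \<beta> = DIM('a)"
    and p_pos: "p > 0" and q_pos: "q > 0"
    and meas: "u \<in> borel_measurable borel" "v \<in> borel_measurable borel"
    and pos: "\<And>x. u x > 0" "\<And>x. v x > 0"
    and u_eq: "\<And>x. ennreal (u x) = riesz_pot \<beta> (\<lambda>y. v y powr q) x"
    and v_eq: "\<And>x. ennreal (v x) = riesz_pot \<beta> (\<lambda>y. u y powr p) x"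
begin

lemma swap: "riesz_system \<alpha> \<beta> q p v u"
  using \<alpha>_pos \<beta>_pos dim p_pos q_pos meas pos u_eq v_eq by unfold_locales

lemma measurable_v_powr: "(\<lambda>y. v y powr q) \<in> borel_measurable borel"
  using meas by (intro powr_real_measurable borel_measurable_const)

lemma u_ge_nn_integral:
  assumes "S \<in> sets borel" "D > 0" "\<And>y. y \<in> S \<Longrightarrow> dist x y \<le> D"
  shows "ennreal (D powr - \<beta>) * (\<integral>\<^sup>+ y. ennreal (indicator S y * v y powr q) \<partial>lborel) \<le> ennreal (u x)"
  unfolding u_eq
  by (rule riesz_pot_ge_nn_integral[OF measurable_v_powr _ assms(1) _ assms(2)])
    (simp_all add: assms(3) \<beta>_pos less_imp_le)

text \<open>All points of the ball are within \<open>2 * r\<close> of \<open>x\<close>, so the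
  kernel is at least \<open>(2 * r) powr - \<beta>\<close>; the volume factor
  \<open>r ^ DIM('a)\<close> turns this into \<open>r powr \<alpha>\<close>. Uniformity of the
  constant allows both \<open>z = x\<close> and \<open>z = 0\<close> later.\<close>

lemma u_ge_ball:
  "\<exists>\<kappa>>0. \<forall>r m x z. r > 0 \<longrightarrow> m \<ge> 0 \<longrightarrow> dist x z \<le> r \<longrightarrow> (\<forall>y\<in>ball z r. m \<le> v y) \<longrightarrow>
    \<kappa> * m powr q * r powr \<alpha> \<le> u x"
proof -
  define \<kappa> where "\<kappa> = 2 powr - \<beta> * unit_ball_vol DIM('a)"
  show ?thesis
  proof (intro exI[of _ \<kappa>] conjI allI impI)
    show "\<kappa> > 0" unfolding \<kappa>_def by simp
    fix r m :: real and x z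
    assume *: "r > 0" "m \<ge> 0" "dist x z \<le> r" "\<forall>y\<in>ball z r. m \<le> v y"
    have D: "dist x y \<le> 2 * r" if "y \<in> ball z r" for y
      using that *(3) dist_triangle[of x y z] by simp
    have "ennreal (\<kappa> * m powr q * r powr \<alpha>) =
        ennreal ((2 * r) powr - \<beta>) * ennreal (m powr q * (unit_ball_vol DIM('a) * r ^ DIM('a)))"
    proof -
      have "r powr - \<beta> * r ^ DIM('a) = r powr \<alpha>"
        using *(1) by (simp add: powr_realpow[symmetric] powr_add[symmetric] dim[symmetric])
      then show ?thesis
        using *(1) by (simp add: ennreal_mult[symmetric] \<kappa>_def powr_mult mult_ac)
    qed
    also have "\<dots> \<le> ennreal ((2 * r) powr - \<beta>) *
        (\<integral>\<^sup>+ y. ennreal (indicator (ball z r) y * v y powr q) \<partial>lborel)"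
      using * q_pos by (intro mult_left_mono nn_integral_indicator_ge powr_mono2) auto
    also have "\<dots> \<le> ennreal (u x)"
      using D *(1) by (intro u_ge_nn_integral) auto
    finally show "\<kappa> * m powr q * r powr \<alpha> \<le> u x"
      using pos(1)[of x] by simp
  qed
qed

text \<open>For \<open>norm x \<ge> 1\<close> the unit ball lies within \<open>2 * norm x\<close> of
  \<open>x\<close>, and the integral of \<open>v powr q\<close> over it is positive and independent
  of \<open>x\<close>.\<close>

lemma u_lower:
  "\<exists>c>0. \<forall>x. norm x \<ge> 1 \<longrightarrow> c * norm x powr - \<beta> \<le> u x"
proof -
  define J where "J = (\<integral>\<^sup>+ y. ennreal (indicator (ball (0::'a) 1) y * v y powr q) \<partial>lborel)"
  \<comment> \<open>A vanishing integral of the strictly positive \<open>v powr q\<close> would make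
    the unit ball a null set.\<close>
  have "J \<noteq> 0"
  proof
    assume "J = 0"
    have "(\<lambda>y. indicator (ball (0::'a) 1) y * v y powr q) \<in> borel_measurable borel"
      by (intro borel_measurable_times borel_measurable_indicator measurable_v_powr) simp
    then have "AE y in lborel. ennreal (indicator (ball (0::'a) 1) y * v y powr q) = 0"
      using \<open>J = 0\<close> unfolding J_def
      by (subst (asm) nn_integral_0_iff_AE)
        (simp_all only: measurable_lborel2 measurable_compose[OF _ measurable_ennreal])
    then have "AE y in lborel. y \<notin> ball (0::'a) 1"
    proof (elim eventually_mono)
      fix y assume "ennreal (indicator (ball (0::'a) 1) y * v y powr q) = 0"
      moreover have "v y powr q > 0" using pos(2)[of y] by simp
      ultimately show "y \<notin> ball 0 1" by (auto simp: indicator_def)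
    qed
    then have "emeasure lborel (ball (0::'a) 1) = 0"
      by (subst (asm) AE_iff_measurable[where N = "ball 0 1"]) auto
    then show False using unit_ball_vol_pos[of "DIM('a)"] by (simp add: emeasure_ball del: unit_ball_vol_pos)
  qed
  \<comment> \<open>\<open>J\<close> is an extended real; a positive real minorant treats finite and
    infinite values alike.\<close>
  obtain j where j: "j > 0" "ennreal j \<le> J"
  proof (cases J)
    case (real r)
    then show ?thesis using that[of r] \<open>J \<noteq> 0\<close> by (cases "r = 0") auto
  next
    case top
    then show ?thesis using that[of 1] by simp
  qed
  have "j * 2 powr - \<beta> * norm x powr - \<beta> \<le> u x" if x: "norm x \<ge> 1" for x
  proof -
    have D: "dist x y \<le> 2 * norm x" if "y \<in> ball 0 1" for y
      using that x dist_triangle[of x y 0] by simp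
    have "ennreal (j * 2 powr - \<beta> * norm x powr - \<beta>) = ennreal ((2 * norm x) powr - \<beta>) * ennreal j"
      using j by (simp add: ennreal_mult[symmetric] powr_mult mult_ac)
    also have "\<dots> \<le> ennreal ((2 * norm x) powr - \<beta>) * J"
      using j by (intro mult_left_mono) auto
    also have "\<dots> \<le> ennreal (u x)"
      unfolding J_def using D x by (intro u_ge_nn_integral) auto
    finally show ?thesis using pos(1)[of x] by simp
  qed
  then show ?thesis using j by (intro exI[of _ "j * 2 powr - \<beta>"]) auto
qed

text \<open>On the ball of radius \<open>norm x / 2\<close> about \<open>x\<close> all norms are
  comparable with \<open>norm x\<close>. The constant \<open>c\<close> is independent of
  \<open>K\<close> and \<open>R\<close>, so a bound on \<open>u\<close> with arbitrarily large
  \<open>K\<close> passes to \<open>v\<close>.\<close>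

lemma v_lower_of_u_lower:
  "\<exists>c>0. \<forall>K>0. \<forall>R>0. (\<forall>y. norm y \<ge> R \<longrightarrow> K * norm y powr - \<beta> \<le> u y) \<longrightarrow>
    (\<forall>x. norm x \<ge> 2 * R \<longrightarrow> c * K powr p * norm x powr - (p * \<beta> - \<alpha>) \<le> v x)"
proof -
  obtain \<kappa> where \<kappa>_pos: "\<kappa> > 0" and ball: "\<forall>r m x z. r > 0 \<longrightarrow> m \<ge> 0 \<longrightarrow>
      dist x z \<le> r \<longrightarrow> (\<forall>y\<in>ball z r. m \<le> u y) \<longrightarrow> \<kappa> * m powr p * r powr \<alpha> \<le> v x"
    using riesz_system.u_ge_ball[OF swap] by (elim exE conjE) (rule that)
  show ?thesis
  proof (intro exI[of _ "\<kappa> * 2 powr - (\<beta> * p) * (1/2) powr \<alpha>"] conjI allI impI)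
    show "0 < \<kappa> * 2 powr - (\<beta> * p) * (1/2) powr \<alpha>"
      using \<kappa>_pos by simp
    fix K R :: real and x :: 'a
    assume *: "K > 0" "R > 0" "\<forall>y. norm y \<ge> R \<longrightarrow> K * norm y powr - \<beta> \<le> u y" "norm x \<ge> 2 * R"
    \<comment> \<open>\<open>m\<close> is the assumed bound evaluated at \<open>2 * norm x\<close>;
      points of the ball have smaller norm, where this decreasing bound is larger.\<close>
    define m where "m = K * (2 * norm x) powr - \<beta>"
    have "\<kappa> * m powr p * (norm x / 2) powr \<alpha> \<le> v x"
    proof (rule ball[rule_format, where z = x])
      fix y assume "y \<in> ball x (norm x / 2)"
      then have y: "norm y \<le> 2 * norm x" "norm y \<ge> norm x / 2"
        using dist_triangle[of 0 y x] dist_triangle[of 0 x y] by (auto simp: dist_commute)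
      then have "norm y \<ge> R" using * by linarith
      have "m \<le> K * norm y powr - \<beta>"
        unfolding m_def using y * \<beta>_pos \<open>norm y \<ge> R\<close> by (intro mult_left_mono powr_mono2') auto
      then show "m \<le> u y" using * \<open>norm y \<ge> R\<close> by force
    qed (use * in \<open>auto simp: m_def\<close>)
    moreover have "\<kappa> * m powr p * (norm x / 2) powr \<alpha> =
        \<kappa> * 2 powr - (\<beta> * p) * (1/2) powr \<alpha> * K powr p * norm x powr - (p * \<beta> - \<alpha>)"
    proof -
      have "m powr p = K powr p * (2 powr - (\<beta> * p) * norm x powr - (\<beta> * p))"
        unfolding m_def using * by (simp add: powr_mult powr_powr)
      moreover have "(norm x / 2) powr \<alpha> = norm x powr \<alpha> * (1/2) powr \<alpha>"
        by (simp add: powr_divide)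
      moreover have "norm x powr - (p * \<beta> - \<alpha>) = norm x powr - (\<beta> * p) * norm x powr \<alpha>"
        by (simp add: powr_add[symmetric] mult.commute)
      ultimately show ?thesis by (simp only: mult_ac)
    qed
    ultimately show "\<kappa> * 2 powr - (\<beta> * p) * (1/2) powr \<alpha> * K powr p * norm x powr - (p * \<beta> - \<alpha>) \<le> v x"
      by linarith
  qed
qed

lemma v_lower:
  "\<exists>c>0. \<exists>R. \<forall>x. norm x \<ge> R \<longrightarrow> c * norm x powr - (p * \<beta> - \<alpha>) \<le> v x"
proof -
  obtain K where K: "K > 0" "\<forall>x. norm x \<ge> 1 \<longrightarrow> K * norm x powr - \<beta> \<le> u x"
    using u_lower by blast
  obtain c where c: "c > 0" "\<And>K R. \<lbrakk>K > 0; R > 0; \<forall>y. norm y \<ge> R \<longrightarrow> K * norm y powr - \<beta> \<le> u y\<rbrakk> \<Longrightarrow>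
    \<forall>x. norm x \<ge> 2 * R \<longrightarrow> c * K powr p * norm x powr - (p * \<beta> - \<alpha>) \<le> v x"
    using v_lower_of_u_lower by blast
  show ?thesis
    using c(2)[OF K(1) _ K(2)] K(1) c(1)
    by (intro exI[of _ "c * K powr p"] conjI exI[of _ 2]) auto
qed

text \<open>By the hypothesis, the \<open>q\<close>-th power of the bound in \<open>v_lower\<close> is at least of order
  \<open>norm x powr - DIM('a)\<close>, which has infinite integral: each dyadic annulus contributes a fixed
  amount.\<close>
lemma u_superlower:
  assumes crit: "q * (p * \<beta> - \<alpha>) \<le> DIM('a)"
  shows "\<exists>R>0. \<forall>x. norm x \<ge> R \<longrightarrow> K * norm x powr - \<beta> \<le> u x"
proof -
  obtain c R0 where c: "c > 0" "\<And>x. norm x \<ge> R0 \<Longrightarrow> c * norm x powr - (p * \<beta> - \<alpha>) \<le> v x"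
    using v_lower by blast
  define R where "R = max R0 1"
  have R: "R \<ge> 1" "R \<ge> R0" by (auto simp: R_def)
  \<comment> \<open>By \<open>crit\<close> the exponent
    \<open>- (p * \<beta> - \<alpha>) * q\<close> is at least minus the dimension, and
    \<open>R \<ge> 1\<close> makes the powers monotone in the exponent.\<close>
  have vq: "c powr q * norm y powr - real DIM('a) \<le> v y powr q" if y: "norm y \<ge> R" for y
  proof -
    have "c powr q * norm y powr - real DIM('a) \<le> c powr q * norm y powr (- (p * \<beta> - \<alpha>) * q)"
      using y R crit by (intro mult_left_mono powr_mono) (auto simp: algebra_simps)
    also have "\<dots> = (c * norm y powr - (p * \<beta> - \<alpha>)) powr q"
      using c(1) by (simp add: powr_mult powr_powr)
    also have "\<dots> \<le> v y powr q"
      using c y R q_pos by (intro powr_mono2) auto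
    finally show ?thesis .
  qed
  define F where "F r = (\<integral>\<^sup>+ y. ennreal (indicator (ball (0::'a) r) y * v y powr q) \<partial>lborel)" for r
  \<comment> \<open>The height \<open>c powr q * (2 * r) powr - real DIM('a)\<close> times the
    volume of a ball of radius \<open>r / 2\<close>; the powers of \<open>r\<close> cancel.\<close>
  define \<delta> where "\<delta> = c powr q * unit_ball_vol DIM('a) * (1/4) ^ DIM('a)"
  have "\<delta> > 0" unfolding \<delta>_def using c(1) by simp
  have step: "F r + ennreal \<delta> \<le> F (2 * r)" if r: "r \<ge> R" for r
  proof -
    have "r > 0" using r R by simp
    \<comment> \<open>A ball of radius \<open>r / 2\<close> about a point of norm
      \<open>3 / 2 * r\<close> lies in the annulus between \<open>r\<close> and
      \<open>2 * r\<close>, disjoint from \<open>ball 0 r\<close>.\<close>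
    obtain z :: 'a where z: "norm z = 3 / 2 * r"
      using vector_choose_size[of "3 / 2 * r"] \<open>r > 0\<close> by auto
    define B where "B = ball z (r / 2)"
    have B: "r \<le> norm y" "norm y < 2 * r" if "y \<in> B" for y
      using that z dist_triangle[of 0 y z] dist_triangle[of 0 z y] by (auto simp: B_def dist_commute)
    have "ennreal \<delta> = ennreal (c powr q * (2 * r) powr - real DIM('a) * (unit_ball_vol DIM('a) * (r / 2) ^ DIM('a)))"
    proof -
      have "(2 * r) powr - real DIM('a) = inverse ((2 * r) ^ DIM('a))"
        using \<open>r > 0\<close> by (simp add: powr_minus powr_realpow)
      moreover have "inverse ((2 * r) ^ DIM('a)) * (r / 2) ^ DIM('a) = (1/4) ^ DIM('a)"
        unfolding power_inverse[symmetric] power_mult_distrib[symmetric] using \<open>r > 0\<close> by simp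
      ultimately show ?thesis by (simp add: \<delta>_def mult_ac)
    qed
    also have "\<dots> \<le> (\<integral>\<^sup>+ y. ennreal (indicator B y * v y powr q) \<partial>lborel)"
      unfolding B_def
    proof (rule nn_integral_indicator_ge)
      fix y assume "y \<in> ball z (r / 2)"
      then have y: "r \<le> norm y" "norm y < 2 * r" using B unfolding B_def by blast+
      have "c powr q * (2 * r) powr - real DIM('a) \<le> c powr q * norm y powr - real DIM('a)"
        using y \<open>r > 0\<close> by (intro mult_left_mono powr_mono2') auto
      also have "\<dots> \<le> v y powr q" using vq y r by simp
      finally show "c powr q * (2 * r) powr - real DIM('a) \<le> v y powr q" .
    qed (use \<open>r > 0\<close> in auto)
    finally have "F r + ennreal \<delta> \<le> F r + (\<integral>\<^sup>+ y. ennreal (indicator B y * v y powr q) \<partial>lborel)"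
      by (rule add_left_mono)
    also have "\<dots> = (\<integral>\<^sup>+ y. ennreal (indicator (ball 0 r) y * v y powr q)
        + ennreal (indicator B y * v y powr q) \<partial>lborel)"
      unfolding F_def B_def
      by (intro nn_integral_add[symmetric];
          simp only: measurable_lborel2;
          intro measurable_compose[OF _ measurable_ennreal] borel_measurable_times
            borel_measurable_indicator measurable_v_powr; simp)
    also have "\<dots> \<le> F (2 * r)"
      unfolding F_def
    proof (rule nn_integral_mono)
      fix y :: 'a
      show "ennreal (indicator (ball 0 r) y * v y powr q) + ennreal (indicator B y * v y powr q)
          \<le> ennreal (indicator (ball 0 (2 * r)) y * v y powr q)"
        using B[of y] \<open>r > 0\<close> by (cases "y \<in> B"; cases "y \<in> ball 0 r") auto
    qed
    finally show ?thesis .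
  qed
  have F: "ennreal (k * \<delta>) \<le> F (2 ^ k * R)" for k :: nat
  proof (induction k)
    case (Suc k)
    have "ennreal (Suc k * \<delta>) = ennreal (k * \<delta>) + ennreal \<delta>"
      using \<open>\<delta> > 0\<close> by (simp add: ennreal_plus[symmetric] algebra_simps del: ennreal_plus)
    also have "\<dots> \<le> F (2 ^ k * R) + ennreal \<delta>"
      using Suc by (rule add_right_mono)
    also have "\<dots> \<le> F (2 * (2 ^ k * R))"
      using R by (intro step) (simp add: mult_le_cancel_right1)
    finally show ?case by (simp add: mult_ac)
  qed simp
  \<comment> \<open>After \<open>k\<close> doublings the ball carries mass at least
    \<open>k * \<delta>\<close>; \<open>k\<close> is chosen so that
    \<open>2 powr - \<beta> * (k * \<delta>)\<close> is at least \<open>K\<close>.\<close>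
  obtain k :: nat where k: "K / (2 powr - \<beta> * \<delta>) \<le> k"
    using real_arch_simple by blast
  define \<rho> where "\<rho> = 2 ^ k * R"
  have "\<rho> > 0" using R by (simp add: \<rho>_def)
  have "K * norm x powr - \<beta> \<le> u x" if x: "norm x \<ge> \<rho>" for x
  proof -
    have "K \<le> 2 powr - \<beta> * (k * \<delta>)"
      using k \<open>\<delta> > 0\<close> by (simp add: field_simps)
    then have "K * norm x powr - \<beta> \<le> 2 powr - \<beta> * (k * \<delta>) * norm x powr - \<beta>"
      by (rule mult_right_mono) simp
    also have "\<dots> = (2 * norm x) powr - \<beta> * (k * \<delta>)"
      by (simp add: powr_mult mult_ac)
    also have "\<dots> \<le> u x"
    proof -
      have D: "dist x y \<le> 2 * norm x" if "y \<in> ball 0 \<rho>" for y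
        using that x dist_triangle[of x y 0] by simp
      have "ennreal ((2 * norm x) powr - \<beta> * (k * \<delta>)) \<le> ennreal ((2 * norm x) powr - \<beta>) * F \<rho>"
        unfolding \<rho>_def ennreal_mult'[OF powr_ge_zero] by (intro mult_left_mono F) simp
      also have "\<dots> \<le> ennreal (u x)"
        unfolding F_def using D x \<open>\<rho> > 0\<close> by (intro u_ge_nn_integral) auto
      finally show ?thesis using pos(1)[of x] by simp
    qed
    finally show ?thesis .
  qed
  then show ?thesis using \<open>\<rho> > 0\<close> by blast
qed

section \<open>Upper bounds for solutions of the system\<close>

text \<open>On the ball of radius \<open>norm x\<close> about 0, \<open>u\<close> is at least
  \<open>\<epsilon> * u x\<close>. Two ball estimates centred at 0, first for \<open>v\<close> and
  then for \<open>u\<close>, give \<open>c * u x powr (p * q) * norm x powr (\<alpha> * (q + 1))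
  \<le> u x\<close>. Since \<open>p * q > 1\<close>, cancelling \<open>u x\<close> leaves a positive
  power of it, and a root is taken.\<close>

lemma u_upper_of_almost_decreasing:
  assumes "\<epsilon> > 0" "\<And>x y. norm y \<le> norm x \<Longrightarrow> \<epsilon> * u x \<le> u y" and pq: "p * q > 1"
  shows "\<exists>C>0. \<forall>x. x \<noteq> 0 \<longrightarrow> u x \<le> C * norm x powr - (\<alpha> * (q + 1) / (p * q - 1))"
proof -
  obtain \<kappa> where \<kappa>_pos: "\<kappa> > 0" and ball: "\<forall>r m x z. r > 0 \<longrightarrow> m \<ge> 0 \<longrightarrow>
      dist x z \<le> r \<longrightarrow> (\<forall>y\<in>ball z r. m \<le> v y) \<longrightarrow> \<kappa> * m powr q * r powr \<alpha> \<le> u x"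
    using u_ge_ball by (elim exE conjE) (rule that)
  obtain \<kappa>' where \<kappa>'_pos: "\<kappa>' > 0" and ball': "\<forall>r m x z. r > 0 \<longrightarrow> m \<ge> 0 \<longrightarrow>
      dist x z \<le> r \<longrightarrow> (\<forall>y\<in>ball z r. m \<le> u y) \<longrightarrow> \<kappa>' * m powr p * r powr \<alpha> \<le> v x"
    using riesz_system.u_ge_ball[OF swap] by (elim exE conjE) (rule that)
  define c where "c = \<kappa> * (\<kappa>' * \<epsilon> powr p) powr q"
  have "c > 0" unfolding c_def using \<kappa>_pos \<kappa>'_pos assms(1) by simp
  define C where "C = c powr - (1 / (p * q - 1))"
  have "u x \<le> C * norm x powr - (\<alpha> * (q + 1) / (p * q - 1))" if x: "x \<noteq> 0" for x
  proof -
    define r where "r = norm x"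
    have r: "r > 0" using x by (simp add: r_def)
    define m where "m = \<kappa>' * (\<epsilon> * u x) powr p * r powr \<alpha>"
    \<comment> \<open>\<open>ball'\<close> applies at every \<open>z\<close> in the ball, so
      \<open>v\<close> is bounded below on all of it and \<open>ball\<close> can follow.\<close>
    have "m \<le> v z" if "z \<in> ball 0 r" for z
      unfolding m_def
      using that assms r pos(1)[of x]
      by (intro ball'[rule_format, where z = 0]) (auto simp: r_def intro: less_imp_le)
    then have "\<kappa> * m powr q * r powr \<alpha> \<le> u x"
      using r \<kappa>'_pos by (intro ball[rule_format, where z = 0]) (auto simp: m_def r_def)
    also have "\<kappa> * m powr q * r powr \<alpha> = c * u x powr (p * q) * r powr (\<alpha> * (q + 1))"
    proof -
      have "m powr q = (\<kappa>' * \<epsilon> powr p) powr q * (u x powr (p * q) * r powr (\<alpha> * q))"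
        unfolding m_def using \<kappa>'_pos pos(1)[of x] assms(1) by (simp add: powr_mult powr_powr)
      moreover have "r powr (\<alpha> * (q + 1)) = r powr (\<alpha> * q) * r powr \<alpha>"
        by (simp add: powr_add[symmetric] algebra_simps)
      ultimately show ?thesis unfolding c_def by (simp only: mult_ac)
    qed
    also have "u x powr (p * q) = u x powr (p * q - 1) * u x"
      using pos(1)[of x] by (simp add: powr_diff)
    finally have "(c * u x powr (p * q - 1) * r powr (\<alpha> * (q + 1))) * u x \<le> 1 * u x"
      by (simp add: mult_ac)
    then have "c * u x powr (p * q - 1) * r powr (\<alpha> * (q + 1)) \<le> 1"
      using pos(1)[of x] by (simp only: mult_le_cancel_right_pos)
    then have "u x powr (p * q - 1) \<le> inverse (c * r powr (\<alpha> * (q + 1)))"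
      using \<open>c > 0\<close> r by (simp add: field_simps)
    then have "(u x powr (p * q - 1)) powr (1 / (p * q - 1))
        \<le> inverse (c * r powr (\<alpha> * (q + 1))) powr (1 / (p * q - 1))"
      using pq by (intro powr_mono2) auto
    moreover have "(u x powr (p * q - 1)) powr (1 / (p * q - 1)) = u x"
      using pos(1)[of x] pq by (simp add: powr_powr)
    moreover have "inverse (c * r powr (\<alpha> * (q + 1))) powr (1 / (p * q - 1))
        = C * r powr - (\<alpha> * (q + 1) / (p * q - 1))"
    proof -
      have "inverse (c * r powr (\<alpha> * (q + 1))) = c powr - 1 * r powr - (\<alpha> * (q + 1))"
        using \<open>c > 0\<close> by (simp add: powr_minus)
      then show ?thesis
        unfolding C_def using \<open>c > 0\<close> by (simp only: powr_mult powr_powr) (simp add: powr_powr)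
    qed
    ultimately show ?thesis by (simp add: r_def)
  qed
  moreover have "C > 0" unfolding C_def using \<open>c > 0\<close> by simp
  ultimately show ?thesis by blast
qed

text \<open>Inserting the bound on \<open>u\<close> into the equation for \<open>v\<close> leaves
  the potential of \<open>norm y powr - (p * a)\<close>. It converges at infinity because
  \<open>p * a > \<alpha>\<close> means \<open>p * a + \<beta> > DIM('a)\<close>, and at 0 because
  \<open>p * a < DIM('a)\<close>.\<close>

lemma v_upper_of_u_upper:
  assumes C: "C > 0" "\<And>x. x \<noteq> 0 \<Longrightarrow> u x \<le> C * norm x powr - a"
    and a: "\<alpha> < p * a" "p * a < DIM('a)"
  shows "\<exists>C'>0. \<forall>x. x \<noteq> 0 \<longrightarrow> v x \<le> C' * norm x powr - (p * a - \<alpha>)"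
proof -
  obtain B where B: "B > 0" "\<And>x::'a. x \<noteq> 0 \<Longrightarrow>
      riesz_pot \<beta> (\<lambda>y. norm y powr - (p * a)) x \<le> ennreal (B * norm x powr (DIM('a) - p * a - \<beta>))"
    using riesz_pot_norm_powr_le[of "p * a" \<beta>, where 'a = 'a] a \<alpha>_pos \<beta>_pos dim by force
  have "v x \<le> (C powr p * B) * norm x powr - (p * a - \<alpha>)" if x: "x \<noteq> 0" for x
  proof -
    have "ennreal (v x) \<le> (\<integral>\<^sup>+ y. ennreal (C powr p) * ennreal (norm y powr - (p * a) / dist x y powr \<beta>) \<partial>lborel)"
      unfolding v_eq riesz_pot_def
    proof (rule nn_integral_mono_AE)
      have "AE y in (lborel :: 'a measure). y \<noteq> 0"
        by (rule AE_lborel_singleton)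
      then show "AE y in lborel. ennreal (u y powr p / dist x y powr \<beta>)
          \<le> ennreal (C powr p) * ennreal (norm y powr - (p * a) / dist x y powr \<beta>)"
      proof (elim eventually_mono)
        fix y :: 'a assume "y \<noteq> 0"
        have "u y powr p \<le> (C * norm y powr - a) powr p"
          using C(2)[OF \<open>y \<noteq> 0\<close>] pos(1)[of y] p_pos by (intro powr_mono2) auto
        also have "\<dots> = C powr p * norm y powr - (p * a)"
          using C(1) by (simp add: powr_mult powr_powr mult.commute)
        finally have "u y powr p / dist x y powr \<beta> \<le> C powr p * (norm y powr - (p * a) / dist x y powr \<beta>)"
          unfolding times_divide_eq_right by (rule divide_right_mono) simp
        then show "ennreal (u y powr p / dist x y powr \<beta>)
          \<le> ennreal (C powr p) * ennreal (norm y powr - (p * a) / dist x y powr \<beta>)"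
          by (simp add: ennreal_mult[symmetric] ennreal_leI)
      qed
    qed
    also have "\<dots> = ennreal (C powr p) * riesz_pot \<beta> (\<lambda>y. norm y powr - (p * a)) x"
      unfolding riesz_pot_def
      by (rule nn_integral_cmult)
        (simp only: measurable_lborel2, intro measurable_compose[OF _ measurable_ennreal]
          borel_measurable_divide powr_real_measurable borel_measurable_dist borel_measurable_norm
          borel_measurable_const measurable_ident_sets, auto)
    also have "\<dots> \<le> ennreal (C powr p) * ennreal (B * norm x powr (DIM('a) - p * a - \<beta>))"
      by (intro mult_left_mono B x) simp
    also have "\<dots> = ennreal (C powr p * B * norm x powr - (p * a - \<alpha>))"
      using B(1) by (simp add: ennreal_mult[symmetric] dim[symmetric] mult_ac)
    finally show ?thesis using B(1) by simp
  qed
  moreover have "C powr p * B > 0" using B C by simp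
  ultimately show ?thesis by blast
qed

end

section \<open>Decay when one component is almost decreasing\<close>

text \<open>Turns competing lower and upper bounds into a contradiction, with
  \<open>A = C + 1\<close> and \<open>B = C\<close>. A single point of norm at least 1 suffices,
  since there the larger decay exponent gives the smaller power.\<close>

lemma powr_norm_coeff_le:
  fixes A B s t R :: real
  assumes le: "\<And>x::'a::euclidean_space. norm x \<ge> R \<Longrightarrow> A * norm x powr - s \<le> B * norm x powr - t"
    and "s \<le> t" "B \<ge> 0"
  shows "A \<le> B"
proof -
  obtain x :: 'a where x: "norm x = max R 1"
    using vector_choose_size[of "max R 1", where 'a = 'a] by (metis max.cobounded2 order_trans zero_le_one)
  have "A * norm x powr - s \<le> B * norm x powr - t"
    by (rule le) (simp add: x)
  also have "\<dots> \<le> B * norm x powr - s"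
    using assms(2,3) x by (intro mult_left_mono powr_mono) auto
  finally show ?thesis
    using x by (simp add: mult_le_cancel_right)
qed

context riesz_system
begin

text \<open>The assumption \<open>p \<le> q\<close> enters through \<open>b \<le> a\<close>: once
  \<open>a < \<beta>\<close>, it yields \<open>p * a = \<alpha> + b < DIM('a)\<close>, as the bound
  on \<open>v\<close> requires.\<close>

lemma decay_of_u_almost_decreasing:
  assumes "\<epsilon> > 0" "\<And>x y. norm y \<le> norm x \<Longrightarrow> \<epsilon> * u x \<le> u y"
    and pq: "p * q > 1" and "p \<le> q"
  shows "\<exists>C>0. \<forall>x. x \<noteq> 0 \<longrightarrow> u x \<le> C * norm x powr - (\<alpha> * (q + 1) / (p * q - 1)) \<and>
    v x \<le> C * norm x powr - (\<alpha> * (p + 1) / (p * q - 1))"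
proof -
  define a where "a = \<alpha> * (q + 1) / (p * q - 1)"
  define b where "b = \<alpha> * (p + 1) / (p * q - 1)"
  have b: "b > 0" "b \<le> a"
    unfolding a_def b_def using \<alpha>_pos p_pos pq \<open>p \<le> q\<close> by (auto intro!: divide_right_mono mult_left_mono)
  have pa: "p * a = \<alpha> + b"
    unfolding a_def b_def using pq by (simp add: field_simps)
  obtain C where C: "C > 0" "\<And>x. x \<noteq> 0 \<Longrightarrow> u x \<le> C * norm x powr - a"
    using u_upper_of_almost_decreasing[OF assms(1,2) pq] unfolding a_def by blast
  have "a < \<beta>"
  proof (rule ccontr)
    assume "\<not> a < \<beta>"
    then have a: "\<beta> \<le> a" by simp
    \<comment> \<open>Clearing the denominator \<open>p * q - 1\<close> turns
      \<open>\<beta> \<le> a\<close> into the hypothesis of \<open>u_superlower\<close>.\<close>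
    then have "q * (p * \<beta> - \<alpha>) \<le> DIM('a)"
      unfolding a_def dim[symmetric] using pq by (simp add: field_simps)
    then obtain R where R: "R > 0" "\<And>x. norm x \<ge> R \<Longrightarrow> (C + 1) * norm x powr - \<beta> \<le> u x"
      using u_superlower by blast
    have "C + 1 \<le> C"
    proof (rule powr_norm_coeff_le[of R "C + 1" \<beta> C a, where 'a = 'a])
      fix x :: 'a assume "norm x \<ge> R"
      then show "(C + 1) * norm x powr - \<beta> \<le> C * norm x powr - a"
        using R C(2)[of x] by force
    qed (use a C in auto)
    then show False by simp
  qed
  then have "\<alpha> < p * a" "p * a < DIM('a)"
    unfolding pa dim[symmetric] using b by auto
  then obtain C' where C': "C' > 0" "\<And>x. x \<noteq> 0 \<Longrightarrow> v x \<le> C' * norm x powr - b"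
    using v_upper_of_u_upper[OF C] unfolding pa by auto
  have "u x \<le> (C + C') * norm x powr - a \<and> v x \<le> (C + C') * norm x powr - b" if "x \<noteq> 0" for x
    using C(2)[OF that] C'(2)[OF that] C(1) C'(1)
    by (auto simp: distrib_right intro: add_increasing add_increasing2)
  then show ?thesis
    unfolding a_def b_def using C(1) C'(1) by (intro exI[of _ "C + C'"]) auto
qed

text \<open>Here \<open>u\<close> is estimated from \<open>v\<close>, and the condition
  \<open>q * b < DIM('a)\<close> is equivalent to \<open>a < \<beta>\<close> because
  \<open>q * b = \<alpha> + a\<close>.\<close>

lemma decay_of_v_almost_decreasing:
  assumes "\<epsilon> > 0" "\<And>x y. norm y \<le> norm x \<Longrightarrow> \<epsilon> * v x \<le> v y" and pq: "p * q > 1"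
  shows "\<exists>C>0. \<forall>x. x \<noteq> 0 \<longrightarrow> u x \<le> C * norm x powr - (\<alpha> * (q + 1) / (p * q - 1)) \<and>
    v x \<le> C * norm x powr - (\<alpha> * (p + 1) / (p * q - 1))"
proof -
  define a where "a = \<alpha> * (q + 1) / (p * q - 1)"
  define b where "b = \<alpha> * (p + 1) / (p * q - 1)"
  have "a > 0"
    unfolding a_def using \<alpha>_pos q_pos pq by simp
  have qb: "q * b = \<alpha> + a" and pa: "p * a = \<alpha> + b"
    unfolding a_def b_def using pq by (simp_all add: field_simps)
  obtain C where C: "C > 0" "\<And>x. x \<noteq> 0 \<Longrightarrow> v x \<le> C * norm x powr - b"
    using riesz_system.u_upper_of_almost_decreasing[OF swap assms(1,2)] pq
    unfolding b_def by (auto simp: mult.commute)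
  have "a < \<beta>"
  proof (rule ccontr)
    assume "\<not> a < \<beta>"
    then have a: "\<beta> \<le> a" by simp
    then have "q * (p * \<beta> - \<alpha>) \<le> DIM('a)"
      unfolding a_def dim[symmetric] using pq by (simp add: field_simps)
    note superlower = u_superlower[OF this]
    obtain c where c: "c > 0" "\<forall>K>0. \<forall>R>0. (\<forall>y. norm y \<ge> R \<longrightarrow> K * norm y powr - \<beta> \<le> u y) \<longrightarrow>
        (\<forall>x. norm x \<ge> 2 * R \<longrightarrow> c * K powr p * norm x powr - (p * \<beta> - \<alpha>) \<le> v x)"
      using v_lower_of_u_lower by blast
    \<comment> \<open>\<open>K\<close> solves \<open>c * K powr p = C + 1\<close>, so the bound
      transferred to \<open>v\<close> has a coefficient exceeding \<open>C\<close>.\<close>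
    define K where "K = ((C + 1) / c) powr (1 / p)"
    have K: "K > 0" "c * K powr p = C + 1"
      unfolding K_def using C(1) c(1) p_pos by (auto simp: powr_powr)
    obtain R where R: "R > 0" "\<forall>x. norm x \<ge> R \<longrightarrow> K * norm x powr - \<beta> \<le> u x"
      using superlower by blast
    have low: "(C + 1) * norm x powr - (p * \<beta> - \<alpha>) \<le> v x" if "norm x \<ge> 2 * R" for x
      using c(2)[rule_format, OF K(1) R(1) R(2)[rule_format] that] unfolding K(2) .
    \<comment> \<open>The lower bound on \<open>v\<close> decays no faster than its upper bound, so
      the coefficients can be compared.\<close>
    have "p * \<beta> - \<alpha> \<le> b"
      using a pa p_pos mult_left_mono[of \<beta> a p] by simp
    have "C + 1 \<le> C"
    proof (rule powr_norm_coeff_le[of "2 * R" "C + 1" "p * \<beta> - \<alpha>" C b, where 'a = 'a])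
      fix x :: 'a assume x: "norm x \<ge> 2 * R"
      then have "x \<noteq> 0" using R(1) by auto
      then show "(C + 1) * norm x powr - (p * \<beta> - \<alpha>) \<le> C * norm x powr - b"
        using low[OF x] C(2)[of x] by linarith
    qed (use \<open>p * \<beta> - \<alpha> \<le> b\<close> C in auto)
    then show False by simp
  qed
  then have "\<alpha> < q * b" "q * b < DIM('a)"
    unfolding qb dim[symmetric] using \<open>a > 0\<close> by auto
  then obtain C' where C': "C' > 0" "\<And>x. x \<noteq> 0 \<Longrightarrow> u x \<le> C' * norm x powr - a"
    using riesz_system.v_upper_of_u_upper[OF swap C] unfolding qb by auto
  have "u x \<le> (C + C') * norm x powr - a \<and> v x \<le> (C + C') * norm x powr - b" if "x \<noteq> 0" for x
    using C(2)[OF that] C'(2)[OF that] C(1) C'(1)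
    by (auto simp: distrib_right intro: add_increasing add_increasing2)
  then show ?thesis
    unfolding a_def b_def using C(1) C'(1) by (intro exI[of _ "C + C'"]) auto
qed

end

section \<open>Combination of the lower bounds with the decay estimates\<close>

theorem theorem1p1:
  fixes u v :: "real^'n \<Rightarrow> real" and \<alpha> p q :: real
  assumes "CARD('n) \<ge> 3"
    and "0 < \<alpha>" and "\<alpha> < real CARD('n)"
    and "p > 0" and "q > 0" and "p * q > 1" and "p \<le> q"
    and "positive_solution_pair \<alpha> p q u v"
  shows "(\<exists>c>0. \<exists>R. \<forall>x. norm x \<ge> R \<longrightarrow>
            u x \<ge> c / norm x powr (real CARD('n) - \<alpha>) \<and>
            v x \<ge> c / norm x powr (min (real CARD('n) - \<alpha>) (p * real CARD('n) - (p + 1) * \<alpha>)))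
    \<and> ((bounded (range u) \<and> bounded (range v) \<and>
         (u \<longlongrightarrow> 0) at_infinity \<and> (v \<longlongrightarrow> 0) at_infinity \<and>
         (\<exists>\<epsilon>0>0. (\<forall>x y. norm y \<le> norm x \<longrightarrow> u y \<ge> \<epsilon>0 * u x) \<or>
                  (\<forall>x y. norm y \<le> norm x \<longrightarrow> v y \<ge> \<epsilon>0 * v x)))
       \<longrightarrow> (\<exists>C>0. \<exists>R. \<forall>x. norm x \<ge> R \<longrightarrow>
              u x \<le> C * norm x powr (- (\<alpha> * (q + 1) / (p * q - 1))) \<and>
              v x \<le> C * norm x powr (- (\<alpha> * (p + 1) / (p * q - 1)))))"
proof -
  define \<beta> where "\<beta> = real CARD('n) - \<alpha>"
  have exponent: "p * real CARD('n) - (p + 1) * \<alpha> = p * \<beta> - \<alpha>"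
    by (simp add: \<beta>_def algebra_simps)
  interpret riesz_system \<alpha> \<beta> p q u v
    using assms unfolding positive_solution_pair_def
    by unfold_locales (auto simp: \<beta>_def riesz_pot_def)
  obtain c1 where c1: "c1 > 0" "\<And>x. norm x \<ge> 1 \<Longrightarrow> c1 * norm x powr - \<beta> \<le> u x"
    using u_lower by blast
  obtain c2 where c2: "c2 > 0" "\<And>x. norm x \<ge> 1 \<Longrightarrow> c2 * norm x powr - \<beta> \<le> v x"
    using riesz_system.u_lower[OF swap] by blast
  obtain c3 R where c3: "c3 > 0" "\<And>x. norm x \<ge> R \<Longrightarrow> c3 * norm x powr - (p * \<beta> - \<alpha>) \<le> v x"
    using v_lower by blast
  define c where "c = min c1 (min c2 c3)"
  have c: "c > 0" "c \<le> c1" "c \<le> c2" "c \<le> c3"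
    unfolding c_def using c1(1) c2(1) c3(1) by auto
  have div: "c / norm x powr s \<le> w" if "c' * norm x powr - s \<le> w" "c \<le> c'" for c' s w and x :: "real^'n"
    using that mult_right_mono[OF that(2), of "norm x powr - s"] by (simp add: powr_minus divide_inverse)
  \<comment> \<open>Two lower bounds on \<open>v\<close> are available, from \<open>v_lower\<close>
    and from the mirror image of \<open>u_lower\<close>; whichever exponent is the minimum, one of
    them has it.\<close>
  have "c / norm x powr \<beta> \<le> u x \<and> c / norm x powr (min \<beta> (p * \<beta> - \<alpha>)) \<le> v x"
    if "norm x \<ge> max R 1" for x
    using div[OF c1(2) c(2)] div[OF c2(2) c(3)] div[OF c3(2) c(4)] that
    by (auto simp: min_def)
  then have lower: "\<exists>c>0. \<exists>R. \<forall>x. norm x \<ge> R \<longrightarrow> c / norm x powr \<beta> \<le> u x \<and>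
      c / norm x powr (min \<beta> (p * \<beta> - \<alpha>)) \<le> v x"
    using c(1) by blast
  have upper: "\<exists>C>0. \<exists>R. \<forall>x. norm x \<ge> R \<longrightarrow>
      u x \<le> C * norm x powr (- (\<alpha> * (q + 1) / (p * q - 1))) \<and>
      v x \<le> C * norm x powr (- (\<alpha> * (p + 1) / (p * q - 1)))"
    if "\<exists>\<epsilon>>0. (\<forall>x y. norm y \<le> norm x \<longrightarrow> \<epsilon> * u x \<le> u y) \<or> (\<forall>x y. norm y \<le> norm x \<longrightarrow> \<epsilon> * v x \<le> v y)"
  proof -
    have "\<exists>C>0. \<forall>x. x \<noteq> 0 \<longrightarrow> u x \<le> C * norm x powr - (\<alpha> * (q + 1) / (p * q - 1)) \<and>
        v x \<le> C * norm x powr - (\<alpha> * (p + 1) / (p * q - 1))"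
      using that decay_of_u_almost_decreasing[OF _ _ \<open>p * q > 1\<close> \<open>p \<le> q\<close>]
        decay_of_v_almost_decreasing[OF _ _ \<open>p * q > 1\<close>] by meson
    moreover have "norm x \<ge> 1 \<longrightarrow> x \<noteq> 0" for x :: "real^'n" by auto
    ultimately show ?thesis by meson
  qed
  show ?thesis
    using lower upper unfolding \<beta>_def[symmetric] exponent by blast
qed

end
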